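(* Let $n\geq 2$ and let $\mathcal{P}$ be a compact subset of the space of continuous functions from $\mathbb{R}^n$ to $\mathbb{R}$ that are (real) analytic on $\mathbb{R}^n\setminus\{0\}$, this space being endowed with the topology of uniform convergence on bounded sets. Assume that $\mathcal{P}$ does not contain the zero function. Then $\mathcal{P}$ is not a universal class of Lyapunov functions.
   Context: Notation: $\mathbb{R}_+=[0,+\infty)$; $M_n(\mathbb{R})$ is the set of real $n\times n$ matrices. Linear switched systems: for a bounded set $\mathscr{M}\subset M_n(\mathbb{R})$, the linear switched system $(\Sigma_{\mathscr{M}})$ is $\dot x(t)=A(t)x(t)$, $t\ge 0$, $x\in\mathbb{R}^n$, where the switching law $A$ is an arbitrary element of $L^\infty(\mathbb{R}_+,\mathscr{M})$, the space of measurable functions from $\mathbb{R}_+$ to $\mathscr{M}$. For a switching law $A$, $\Phi_A(t,s)$ denotes the fundamental matrix from $s$ to $t$, so that every solution (trajectory) satisfies $x(t)=\Phi_A(t,0)x(0)$. Stability: $(\Sigma_{\mathscr{M}})$ is uniformly exponentially stable if there exist $C,\gamma>0$ such that $\|\Phi_A(t,0)\|\le Ce^{-\gamma t}$ for every switching law $A$ and every $t\ge 0$. Common Lyapunov function: a continuous function $V:\mathbb{R}^n\to\mathbb{R}_+$ is a common Lyapunov function for $(\Sigma_{\mathscr{M}})$ if it is positive definite (i.e. $V(0)=0$ and $V(x)>0$ for $x\ne 0$) and $V$ is strictly decreasing along each nonzero trajectory of $(\Sigma_{\mathscr{M}})$ (i.e. $t\mapsto V(x(t))$ is strictly decreasing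 on $\mathbb{R}_+$ for every trajectory $x(\cdot)$ with $x(0)\neq 0$). Universality: a set $\mathcal{P}$ of functions from $\mathbb{R}^n$ to $\mathbb{R}$ is a universal class of Lyapunov functions if for every bounded set $\mathscr{M}\subset M_n(\mathbb{R})$ such that $(\Sigma_{\mathscr{M}})$ is uniformly exponentially stable there exists a common Lyapunov function for $(\Sigma_{\mathscr{M}})$ in $\mathcal{P}$. *)

theory Defs
  imports "HOL-Analysis.Analysis"
begin

section \<open>Linear switched systems\<close>

text \<open>Measurability is Lebesgue measurability. If the set of modes \<open>M\<close> is bounded, such a function
  is automatically in \<open>L\<^sup>\<infinity>\<close>. The values of \<open>A\<close> at negative times are irrelevant.\<close>

definition switching_law :: "(real^'n^'n) set \<Rightarrow> (real \<Rightarrow> real^'n^'n) \<Rightarrow> bool" where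
  "switching_law M A \<longleftrightarrow>
     A \<in> borel_measurable (lebesgue_on {0..}) \<and> (\<forall>t\<ge>0. A t \<in> M)"

text \<open>Solutions of the switched equation are meant in the sense of Caratheodory (locally absolutely
  continuous, equation satisfied almost everywhere), here in the equivalent integral form: for
  bounded measurable \<open>A\<close> and continuous \<open>x\<close> the integrand is bounded and measurable on bounded
  intervals, so that the gauge integral is the Lebesgue integral.\<close>

definition solution :: "(real \<Rightarrow> real^'n^'n) \<Rightarrow> (real \<Rightarrow> real^'n) \<Rightarrow> bool" where
  "solution A x \<longleftrightarrow> continuous_on {0..} x \<and>
     (\<forall>t\<ge>0. ((\<lambda>\<tau>. A \<tau> *v x \<tau>) has_integral (x t - x 0)) {0..t})"

definition trajectory :: "(real^'n^'n) set \<Rightarrow> (real \<Rightarrow> real^'n) \<Rightarrow> bool" where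
  "trajectory M x \<longleftrightarrow> (\<exists>A. switching_law M A \<and> solution A x)"

text \<open>\<open>fundamental_matrix A s \<Phi>\<close> says that \<open>\<Phi> t\<close> is the fundamental matrix of \<open>A\<close> from \<open>s\<close> to \<open>t\<close>,
  for all \<open>t \<ge> s\<close>: the matrix solution of the equation equal to the identity at time \<open>s\<close>.
  For bounded measurable \<open>A\<close> and \<open>s \<ge> 0\<close> such a \<open>\<Phi>\<close> exists and is unique on \<open>{s..}\<close>.\<close>

definition fundamental_matrix ::
    "(real \<Rightarrow> real^'n^'n) \<Rightarrow> real \<Rightarrow> (real \<Rightarrow> real^'n^'n) \<Rightarrow> bool" where
  "fundamental_matrix A s \<Phi> \<longleftrightarrow> continuous_on {s..} \<Phi> \<and>
     (\<forall>t\<ge>s. ((\<lambda>\<tau>. A \<tau> ** \<Phi> \<tau>) has_integral (\<Phi> t - mat 1)) {s..t})"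

definition uniformly_exponentially_stable :: "(real^'n^'n) set \<Rightarrow> bool" where
  "uniformly_exponentially_stable M \<longleftrightarrow>
     (\<exists>C>0. \<exists>\<gamma>>0. \<forall>A \<Phi>. switching_law M A \<longrightarrow> fundamental_matrix A 0 \<Phi> \<longrightarrow>
        (\<forall>t\<ge>0. onorm ((*v) (\<Phi> t)) \<le> C * exp (- \<gamma> * t)))"

definition common_lyapunov_function :: "(real^'n^'n) set \<Rightarrow> (real^'n \<Rightarrow> real) \<Rightarrow> bool" where
  "common_lyapunov_function M V \<longleftrightarrow>
     continuous_on UNIV V \<and> (\<forall>x. 0 \<le> V x) \<and>
     V 0 = 0 \<and> (\<forall>x. x \<noteq> 0 \<longrightarrow> 0 < V x) \<and>
     (\<forall>x. trajectory M x \<longrightarrow> x 0 \<noteq> 0 \<longrightarrow> strict_antimono_on {0..} (\<lambda>t. V (x t)))"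

definition universal_class :: "(real^'n \<Rightarrow> real) set \<Rightarrow> bool" where
  "universal_class P \<longleftrightarrow>
     (\<forall>M. bounded M \<longrightarrow> uniformly_exponentially_stable M \<longrightarrow>
        (\<exists>V\<in>P. common_lyapunov_function M V))"

section \<open>The space of functions\<close>

text \<open>Local expansion into a multivariate power series. Multi-indices are functions
  \<open>'n \<Rightarrow> nat\<close>, and the sum over all of them is unconditional (equivalently, absolute).\<close>

definition real_analytic_on :: "(real^'n \<Rightarrow> real) \<Rightarrow> (real^'n) set \<Rightarrow> bool"
    (infix "real'_analytic'_on" 50) where
  "f real_analytic_on S \<longleftrightarrow>
     (\<forall>a\<in>S. \<exists>r>0. \<exists>c :: ('n \<Rightarrow> nat) \<Rightarrow> real. \<forall>x\<in>ball a r.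
        ((\<lambda>\<alpha>. c \<alpha> * (\<Prod>i\<in>UNIV. (x $ i - a $ i) ^ \<alpha> i)) has_sum f x) UNIV)"

definition analytic_off_origin :: "(real^'n \<Rightarrow> real) set" where
  "analytic_off_origin = {f. continuous_on UNIV f \<and> f real_analytic_on (UNIV - {0})}"

text \<open>The topology of uniform convergence on bounded sets, on the set of all real functions.\<close>

definition uniform_on_bounded_topology :: "('a::metric_space \<Rightarrow> real) topology" where
  "uniform_on_bounded_topology = topology (\<lambda>U. \<forall>f\<in>U. \<exists>B \<epsilon>. bounded B \<and> \<epsilon> > 0 \<and>
      {g. \<forall>x\<in>B. \<bar>g x - f x\<bar> < \<epsilon>} \<subseteq> U)"

lemma openin_uniform_on_bounded_topology:
  "openin uniform_on_bounded_topology U \<longleftrightarrow>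
     (\<forall>f\<in>U. \<exists>B \<epsilon>. bounded B \<and> \<epsilon> > 0 \<and> {g. \<forall>x\<in>B. \<bar>g x - f x\<bar> < \<epsilon>} \<subseteq> U)"
proof -
  define N where "N f B \<epsilon> = {g :: 'a \<Rightarrow> real. \<forall>x\<in>B. \<bar>g x - f x\<bar> < \<epsilon>}" for f B and \<epsilon> :: real
  define op where "op U \<longleftrightarrow> (\<forall>f\<in>U. \<exists>B \<epsilon>. bounded B \<and> \<epsilon> > 0 \<and> N f B \<epsilon> \<subseteq> U)" for U
  have opI: "op U" if "\<And>f. f \<in> U \<Longrightarrow> \<exists>B \<epsilon>. bounded B \<and> \<epsilon> > 0 \<and> N f B \<epsilon> \<subseteq> U" for U
    using that by (simp add: op_def)
  have opE: "\<exists>B \<epsilon>. bounded B \<and> \<epsilon> > 0 \<and> N f B \<epsilon> \<subseteq> U" if "op U" "f \<in> U" for f U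
    using that by (simp add: op_def)
  have N_mono: "N f (B \<union> C) (min \<epsilon> \<delta>) \<subseteq> N f B \<epsilon> \<inter> N f C \<delta>" for f B C \<epsilon> \<delta>
    by (auto simp: N_def)
  have inter: "op (S \<inter> T)" if S: "op S" and T: "op T" for S T
  proof (rule opI)
    fix f assume f: "f \<in> S \<inter> T"
    obtain B \<epsilon> where 1: "bounded B" "\<epsilon> > 0" "N f B \<epsilon> \<subseteq> S"
      using opE[OF S, of f] f by auto
    obtain C \<delta> where 2: "bounded C" "\<delta> > 0" "N f C \<delta> \<subseteq> T"
      using opE[OF T, of f] f by auto
    have "bounded (B \<union> C)" "min \<epsilon> \<delta> > 0"
      using 1(1,2) 2(1,2) by simp_all
    moreover have "N f (B \<union> C) (min \<epsilon> \<delta>) \<subseteq> S \<inter> T"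
      using N_mono[of f B C \<epsilon> \<delta>] 1(3) 2(3) by blast
    ultimately show "\<exists>B \<epsilon>. bounded B \<and> \<epsilon> > 0 \<and> N f B \<epsilon> \<subseteq> S \<inter> T"
      by (intro exI[of _ "B \<union> C"] exI[of _ "min \<epsilon> \<delta>"] conjI)
  qed
  have union: "op (\<Union>K)" if K: "\<forall>S\<in>K. op S" for K
  proof (rule opI)
    fix f assume "f \<in> \<Union>K"
    then obtain S where S: "S \<in> K" "f \<in> S" by (rule UnionE)
    obtain B \<epsilon> where "bounded B" "\<epsilon> > 0" "N f B \<epsilon> \<subseteq> S"
      using opE[OF bspec[OF K S(1)] S(2)] by auto
    moreover from this(3) have "N f B \<epsilon> \<subseteq> \<Union>K"
      using Union_upper[OF S(1)] by (rule subset_trans)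
    ultimately show "\<exists>B \<epsilon>. bounded B \<and> \<epsilon> > 0 \<and> N f B \<epsilon> \<subseteq> \<Union>K"
      by (intro exI[of _ B] exI[of _ \<epsilon>] conjI)
  qed
  have "istopology op"
    unfolding istopology_def using inter union by simp
  then have "openin (topology op) = op"
    by (rule topology_inverse')
  moreover have "uniform_on_bounded_topology = topology op"
    unfolding uniform_on_bounded_topology_def op_def N_def by (rule refl)
  ultimately have "openin uniform_on_bounded_topology U = op U"
    by simp
  then show ?thesis
    by (simp only: op_def N_def)
qed

end

theory Submission
  imports Defs "HOL-Complex_Analysis.Cauchy_Integral_Formula" "HOL-Real_Asymp.Real_Asymp"
begin

text \<open>The modes \<open>x \<mapsto> x\<^sub>k y - (1 + \<epsilon>) x\<close> with \<open>\<parallel>y\<parallel>\<^sub>\<infinity> \<le> 1\<close> contract the maximum norm at rate \<open>\<epsilon>\<close>, so for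
  \<open>\<epsilon> > 0\<close> they form a uniformly exponentially stable system. As \<open>\<epsilon> \<rightarrow> 0\<close>, compactness gives a cluster
  point \<open>f \<in> P\<close> of the corresponding Lyapunov functions. The limit system moves any \<open>x\<close> with
  \<open>\<bar>x\<^sub>k\<bar> = \<parallel>x\<parallel>\<^sub>\<infinity>\<close> along a segment towards any other point of the face of the cube through \<open>x\<close>, and back;
  hence \<open>f\<close> is constant on every face of every cube centred at the origin. By analyticity it is then
  constant on the lines carrying these faces that miss the origin, and two such lines in different
  coordinate directions link a given point to points arbitrarily close to the origin. Thus
  \<open>f = f 0 = 0\<close>, which is excluded.\<close>

lemma infnorm_leI_cart:
  fixes x :: "real^'n"
  assumes "\<And>i. \<bar>x $ i\<bar> \<le> B"
  shows "infnorm x \<le> B"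
  unfolding infnorm_cart by (rule cSup_least) (use assms in auto)

lemma bounded_linear_matrix_vector_mult_left:
  fixes v :: "real^'n"
  shows "bounded_linear (\<lambda>M :: real^'n^'m. M *v v)"
  unfolding linear_conv_bounded_linear[symmetric]
  by (rule linearI) (simp_all add: matrix_vector_mult_add_rdistrib scaleR_matrix_vector_assoc)

section \<open>The switched systems \<open>modes \<epsilon>\<close>\<close>

text \<open>This is a rank-one matrix, \<open>y\<close> times the transposed \<open>k\<close>-th
  basis vector, minus \<open>1 + \<epsilon>\<close> times the identity. If
  \<open>infnorm y \<le> 1\<close>, the rank-one part does not increase the maximum norm, so the
  damping wins by the margin \<open>\<epsilon>\<close>.\<close>

definition mode :: "real \<Rightarrow> 'n \<Rightarrow> real^'n \<Rightarrow> real^'n^'n" where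
  "mode \<epsilon> k y = (\<chi> i j. (if j = k then y $ i else 0) - (if j = i then 1 + \<epsilon> else 0))"

definition modes :: "real \<Rightarrow> (real^'n^'n) set" where
  "modes \<epsilon> = {mode \<epsilon> k y | k y. infnorm y \<le> 1}"

lemma mode_mult_vec: "mode \<epsilon> k y *v x = x $ k *\<^sub>R y - (1 + \<epsilon>) *\<^sub>R x"
proof -
  have "(mode \<epsilon> k y *v x) $ i = y $ i * x $ k - (1 + \<epsilon>) * x $ i" for i
  proof -
    have "(mode \<epsilon> k y *v x) $ i
        = (\<Sum>j\<in>UNIV. (if j = k then y $ i * x $ j else 0) - (if j = i then (1 + \<epsilon>) * x $ j else 0))"
      by (auto simp: mode_def matrix_vector_mult_def left_diff_distrib intro!: sum.cong)
    then show ?thesis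
      by (simp add: sum_subtractf)
  qed
  then show ?thesis
    by (simp add: vec_eq_iff mult.commute)
qed

lemma bounded_modes: "bounded (modes \<epsilon> :: (real^'n^'n) set)"
proof -
  have entry: "norm (mode \<epsilon> k y $ i $ j) \<le> 1 + \<bar>1 + \<epsilon>\<bar>" if "infnorm y \<le> 1" for k i j and y :: "real^'n"
    using component_le_infnorm_cart[of y i] that by (auto simp: mode_def)
  have "norm (mode \<epsilon> k y) \<le> (\<Sum>i\<in>(UNIV::'n set). \<Sum>j\<in>(UNIV::'n set). 1 + \<bar>1 + \<epsilon>\<bar>)"
    if "infnorm y \<le> 1" for k and y :: "real^'n"
  proof -
    have "norm (mode \<epsilon> k y) \<le> (\<Sum>i\<in>UNIV. norm (mode \<epsilon> k y $ i))"
      unfolding norm_vec_def by (rule L2_set_le_sum) simp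
    also have "\<dots> \<le> (\<Sum>i\<in>UNIV. \<Sum>j\<in>UNIV. norm (mode \<epsilon> k y $ i $ j))"
      by (intro sum_mono) (simp add: norm_vec_def[where 'b='n and 'a=real] L2_set_le_sum)
    also have "\<dots> \<le> (\<Sum>i\<in>(UNIV::'n set). \<Sum>j\<in>(UNIV::'n set). 1 + \<bar>1 + \<epsilon>\<bar>)"
      by (intro sum_mono entry that)
    finally show ?thesis .
  qed
  then show ?thesis
    by (auto simp: modes_def intro!: boundedI)
qed

section \<open>Exponential decay in the maximum norm\<close>

lemma solution_increment:
  assumes "solution A x" "0 \<le> s" "s \<le> t"
  shows "((\<lambda>\<tau>. A \<tau> *v x \<tau>) has_integral (x t - x s)) {s..t}"
proof -
  have t: "((\<lambda>\<tau>. A \<tau> *v x \<tau>) has_integral (x t - x 0)) {0..t}"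
    and s: "((\<lambda>\<tau>. A \<tau> *v x \<tau>) has_integral (x s - x 0)) {0..s}"
    using assms by (auto simp: solution_def)
  have "(\<lambda>\<tau>. A \<tau> *v x \<tau>) integrable_on {s..t}"
    using integrable_subinterval_real[OF has_integral_integrable[OF t], of s t] assms by simp
  then obtain d where d: "((\<lambda>\<tau>. A \<tau> *v x \<tau>) has_integral d) {s..t}"
    by (auto simp: integrable_on_def)
  have "(x s - x 0) + d = x t - x 0"
    using has_integral_combine[OF assms(2,3) s d] t by (rule has_integral_unique)
  then have "d = x t - x s"
    by (simp add: algebra_simps)
  with d show ?thesis by simp
qed

text \<open>With \<open>x\<close> frozen at time \<open>s\<close>, one step combines
  \<open>x s\<close> with weight \<open>1 - (1 + \<epsilon>) * h\<close> and a vector of norm at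
  most \<open>infnorm (x s)\<close> with weight \<open>h\<close>. These weights add up to
  \<open>1 - \<epsilon> * h\<close>. Freezing costs only order \<open>h^2\<close>, because the
  solution has speed at most \<open>(2 + \<epsilon>) * K\<close>.\<close>

lemma infnorm_euler_step:
  fixes x :: "real \<Rightarrow> real^'n"
  assumes A: "\<And>\<tau>. \<tau> \<ge> 0 \<Longrightarrow> A \<tau> \<in> modes \<epsilon>" and x: "solution A x" and "\<epsilon> \<ge> 0"
    and K: "\<And>\<tau>. \<tau> \<in> {0..T} \<Longrightarrow> infnorm (x \<tau>) \<le> K"
    and st: "0 \<le> s" "0 \<le> h" "s + h \<le> T" "(1 + \<epsilon>) * h \<le> 1"
  shows "infnorm (x (s + h)) \<le> (1 - \<epsilon> * h) * infnorm (x s) + (2 + \<epsilon>)\<^sup>2 * K * h\<^sup>2"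
proof -
  have "0 \<le> K"
    using K[of s] st infnorm_pos_le[of "x s"] by auto
  have A_bound: "\<bar>(A \<tau> *v x \<tau>) $ i + (1 + \<epsilon>) * v $ i\<bar> \<le> infnorm (x \<tau>) + (1 + \<epsilon>) * infnorm (x \<tau> - v)"
    if "\<tau> \<ge> 0" for \<tau> i v
  proof -
    obtain k y where y: "A \<tau> = mode \<epsilon> k y" "infnorm y \<le> 1"
      using A[OF \<open>\<tau> \<ge> 0\<close>] by (auto simp: modes_def)
    have "(A \<tau> *v x \<tau>) $ i + (1 + \<epsilon>) * v $ i = x \<tau> $ k * y $ i - (1 + \<epsilon>) * (x \<tau> - v) $ i"
      by (simp add: y mode_mult_vec algebra_simps)
    moreover have "\<bar>x \<tau> $ k * y $ i\<bar> \<le> infnorm (x \<tau>) * 1"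
      unfolding abs_mult
      by (intro mult_mono component_le_infnorm_cart order_trans[OF component_le_infnorm_cart y(2)])
        (auto simp: infnorm_pos_le)
    moreover have "\<bar>(1 + \<epsilon>) * (x \<tau> - v) $ i\<bar> \<le> (1 + \<epsilon>) * infnorm (x \<tau> - v)"
      using mult_left_mono[OF component_le_infnorm_cart[of "x \<tau> - v" i], of "1 + \<epsilon>"] \<open>\<epsilon> \<ge> 0\<close>
      by (simp add: abs_mult)
    ultimately show ?thesis
      by linarith
  qed
  have comp_int: "((\<lambda>\<tau>. (A \<tau> *v x \<tau>) $ i) has_integral (x t - x s) $ i) (cbox s t)" if "s \<le> t" for i t
    using has_integral_linear[OF solution_increment[OF x st(1) that] bounded_linear_vec_nth[of i]]
    by (simp add: o_def)
  have lip: "infnorm (x t - x s) \<le> (2 + \<epsilon>) * K * h" if t: "s \<le> t" "t \<le> s + h" for t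
  proof (rule infnorm_leI_cart)
    fix i
    have "\<bar>(A \<tau> *v x \<tau>) $ i\<bar> \<le> (2 + \<epsilon>) * K" if "\<tau> \<in> cbox s t" for \<tau>
    proof -
      have \<tau>: "\<tau> \<ge> 0" "\<tau> \<in> {0..T}"
        using that t st by auto
      have "\<bar>(A \<tau> *v x \<tau>) $ i\<bar> \<le> infnorm (x \<tau>) + (1 + \<epsilon>) * infnorm (x \<tau>)"
        using A_bound[OF \<tau>(1), of i 0] by simp
      also have "\<dots> \<le> K + (1 + \<epsilon>) * K"
        using \<open>\<epsilon> \<ge> 0\<close> by (intro add_mono mult_left_mono K \<tau>) auto
      finally show ?thesis
        by (simp add: algebra_simps)
    qed
    then have "norm ((x t - x s) $ i) \<le> (2 + \<epsilon>) * K * measure lborel (cbox s t)"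
      using \<open>0 \<le> K\<close> \<open>\<epsilon> \<ge> 0\<close> by (intro has_integral_bound[OF _ comp_int[OF t(1)]]) auto
    also have "\<dots> = (2 + \<epsilon>) * K * (t - s)"
      using t by simp
    also have "\<dots> \<le> (2 + \<epsilon>) * K * h"
      using t \<open>0 \<le> K\<close> \<open>\<epsilon> \<ge> 0\<close> by (intro mult_left_mono) auto
    finally show "\<bar>(x t - x s) $ i\<bar> \<le> (2 + \<epsilon>) * K * h"
      by simp
  qed
  define E where "E = infnorm (x s) + (2 + \<epsilon>) * ((2 + \<epsilon>) * K * h)"
  have "infnorm (x (s + h) - x s + h *\<^sub>R (1 + \<epsilon>) *\<^sub>R x s) \<le> E * h"
  proof (rule infnorm_leI_cart)
    fix i
    have "norm ((A \<tau> *v x \<tau>) $ i + (1 + \<epsilon>) * x s $ i) \<le> E" if "\<tau> \<in> cbox s (s + h)" for \<tau>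
    proof -
      have l: "infnorm (x \<tau> - x s) \<le> (2 + \<epsilon>) * K * h"
        using that by (intro lip) auto
      have "norm ((A \<tau> *v x \<tau>) $ i + (1 + \<epsilon>) * x s $ i) \<le> infnorm (x \<tau>) + (1 + \<epsilon>) * infnorm (x \<tau> - x s)"
        using A_bound[of \<tau> i "x s"] that st by auto
      also have "infnorm (x \<tau>) \<le> infnorm (x s) + infnorm (x \<tau> - x s)"
        using infnorm_triangle[of "x s" "x \<tau> - x s"] by simp
      finally have "norm ((A \<tau> *v x \<tau>) $ i + (1 + \<epsilon>) * x s $ i)
          \<le> infnorm (x s) + (2 + \<epsilon>) * infnorm (x \<tau> - x s)"
        by (simp add: algebra_simps)
      also have "\<dots> \<le> E"
        unfolding E_def using \<open>\<epsilon> \<ge> 0\<close> by (intro add_left_mono mult_left_mono l) auto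
      finally show ?thesis .
    qed
    moreover have "((\<lambda>\<tau>. (A \<tau> *v x \<tau>) $ i + (1 + \<epsilon>) * x s $ i) has_integral
        (x (s + h) - x s) $ i + h * ((1 + \<epsilon>) * x s $ i)) (cbox s (s + h))"
      using has_integral_const_real[of "(1 + \<epsilon>) * x s $ i" s "s + h"] st
      by (intro has_integral_add comp_int) auto
    moreover have "0 \<le> E"
      unfolding E_def using \<open>\<epsilon> \<ge> 0\<close> \<open>0 \<le> K\<close> st
      by (intro add_nonneg_nonneg mult_nonneg_nonneg infnorm_pos_le) auto
    ultimately have "norm ((x (s + h) - x s) $ i + h * ((1 + \<epsilon>) * x s $ i)) \<le> E * measure lborel (cbox s (s + h))"
      by (intro has_integral_bound) auto
    then show "\<bar>(x (s + h) - x s + h *\<^sub>R (1 + \<epsilon>) *\<^sub>R x s) $ i\<bar> \<le> E * h"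
      using st by simp
  qed
  moreover have "infnorm (x (s + h)) \<le> infnorm ((1 - (1 + \<epsilon>) * h) *\<^sub>R x s)
      + infnorm (x (s + h) - x s + h *\<^sub>R (1 + \<epsilon>) *\<^sub>R x s)"
    using infnorm_triangle[of "(1 - (1 + \<epsilon>) * h) *\<^sub>R x s" "x (s + h) - x s + h *\<^sub>R (1 + \<epsilon>) *\<^sub>R x s"]
    by (simp add: algebra_simps)
  \<comment> \<open>The restriction on \<open>h\<close> makes the factor nonnegative, so no absolute
    value remains.\<close>
  moreover have "infnorm ((1 - (1 + \<epsilon>) * h) *\<^sub>R x s) = (1 - (1 + \<epsilon>) * h) * infnorm (x s)"
    using st by (simp add: infnorm_mul)
  ultimately have "infnorm (x (s + h)) \<le> (1 - (1 + \<epsilon>) * h) * infnorm (x s) + E * h"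
    by linarith
  also have "\<dots> = (1 - \<epsilon> * h) * infnorm (x s) + (2 + \<epsilon>)\<^sup>2 * K * h\<^sup>2"
    by (simp add: E_def algebra_simps power2_eq_square)
  finally show ?thesis .
qed

text \<open>Summing the errors of the Euler method avoids differentiating the solution, which is only
  absolutely continuous.\<close>

lemma modes_infnorm_decay:
  fixes x :: "real \<Rightarrow> real^'n"
  assumes A: "\<And>\<tau>. \<tau> \<ge> 0 \<Longrightarrow> A \<tau> \<in> modes \<epsilon>" and x: "solution A x" and "\<epsilon> \<ge> 0" and "t \<ge> 0"
  shows "infnorm (x t) \<le> exp (- \<epsilon> * t) * infnorm (x 0)"
proof -
  \<comment> \<open>The crude bound \<open>K\<close> enters only the error term, which vanishes in
    the limit.\<close>
  have "compact ((\<lambda>\<tau>. infnorm (x \<tau>)) ` {0..t})"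
    using x by (intro compact_continuous_image continuous_on_infnorm)
      (auto simp: solution_def intro: continuous_on_subset)
  then obtain K where K: "\<And>\<tau>. \<tau> \<in> {0..t} \<Longrightarrow> infnorm (x \<tau>) \<le> K"
    by (metis compact_imp_bounded bounded_real abs_le_D1 imageI)
  have "0 \<le> K"
    using K[of 0] \<open>t \<ge> 0\<close> infnorm_pos_le[of "x 0"] by auto
  define D where "D = (2 + \<epsilon>)\<^sup>2 * K"
  have "D \<ge> 0"
    using \<open>0 \<le> K\<close> by (simp add: D_def)
  \<comment> \<open>There are \<open>n\<close> steps of length \<open>t / n\<close>; each adds an
    error \<open>D * h^2\<close>, and earlier errors are multiplied by a factor of at most 1, so
    they only add up.\<close>
  have est: "infnorm (x t) \<le> exp (- \<epsilon> * t) * infnorm (x 0) + D * t\<^sup>2 / real n"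
    if n: "n > 0" "real n \<ge> (1 + \<epsilon>) * t" for n
  proof -
    define h where "h = t / real n"
    have h: "h \<ge> 0" "(1 + \<epsilon>) * h \<le> 1" "real n * h = t"
      using n \<open>t \<ge> 0\<close> by (auto simp: h_def field_simps)
    have \<epsilon>h: "0 \<le> 1 - \<epsilon> * h" "1 - \<epsilon> * h \<le> 1" "1 - \<epsilon> * h \<le> exp (- \<epsilon> * h)"
      using h \<open>\<epsilon> \<ge> 0\<close> exp_ge_add_one_self[of "- \<epsilon> * h"] by (auto simp: algebra_simps)
    have "infnorm (x (real k * h)) \<le> exp (- \<epsilon> * (real k * h)) * infnorm (x 0) + real k * (D * h\<^sup>2)"
      if "k \<le> n" for k
      using that
    proof (induction k)
      case 0
      then show ?case by simp
    next
      case (Suc k)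
      have "real (Suc k) * h \<le> real n * h"
        using Suc.prems h by (intro mult_right_mono) auto
      then have le: "real k * h + h \<le> t"
        using h by (simp add: algebra_simps)
      have "infnorm (x (real k * h + h)) \<le> (1 - \<epsilon> * h) * infnorm (x (real k * h)) + D * h\<^sup>2"
        unfolding D_def using h le \<open>\<epsilon> \<ge> 0\<close>
        by (intro infnorm_euler_step[OF A x _ K]) auto
      also have "\<dots> \<le> (1 - \<epsilon> * h) * (exp (- \<epsilon> * (real k * h)) * infnorm (x 0) + real k * (D * h\<^sup>2)) + D * h\<^sup>2"
        using Suc \<epsilon>h by (intro add_right_mono mult_left_mono) auto
      also have "\<dots> = (1 - \<epsilon> * h) * (exp (- \<epsilon> * (real k * h)) * infnorm (x 0))
          + (1 - \<epsilon> * h) * (real k * (D * h\<^sup>2)) + D * h\<^sup>2"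
        by (simp add: distrib_left)
      also have "\<dots> \<le> exp (- \<epsilon> * h) * (exp (- \<epsilon> * (real k * h)) * infnorm (x 0))
          + 1 * (real k * (D * h\<^sup>2)) + D * h\<^sup>2"
        using \<epsilon>h \<open>D \<ge> 0\<close> infnorm_pos_le[of "x 0"]
        by (intro add_right_mono add_mono mult_right_mono) auto
      also have "\<dots> = exp (- \<epsilon> * (real (Suc k) * h)) * infnorm (x 0) + real (Suc k) * (D * h\<^sup>2)"
        by (simp add: algebra_simps flip: exp_add)
      finally show ?case
        by (simp add: algebra_simps)
    qed
    from this[of n] have "infnorm (x t) \<le> exp (- \<epsilon> * t) * infnorm (x 0) + real n * (D * h\<^sup>2)"
      by (simp add: h)
    also have "real n * (D * h\<^sup>2) = D * t\<^sup>2 / real n"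
      using n by (simp add: h_def power2_eq_square)
    finally show ?thesis .
  qed
  have ev: "\<forall>\<^sub>F n in sequentially. infnorm (x t) \<le> exp (- \<epsilon> * t) * infnorm (x 0) + D * t\<^sup>2 / real n"
  proof -
    have "\<forall>\<^sub>F n in sequentially. real n \<ge> (1 + \<epsilon>) * t"
      using filterlim_real_sequentially by (simp add: filterlim_at_top)
    then show ?thesis
      using eventually_gt_at_top[of 0] by eventually_elim (rule est)
  qed
  have "(\<lambda>n. exp (- \<epsilon> * t) * infnorm (x 0) + D * t\<^sup>2 / real n)
      \<longlonglongrightarrow> exp (- \<epsilon> * t) * infnorm (x 0) + 0"
    by (intro tendsto_intros lim_const_over_n)
  then show ?thesis
    using tendsto_lowerbound[OF _ ev] by simp
qed

section \<open>Uniform exponential stability and explicit trajectories\<close>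

text \<open>Evaluation of a matrix at \<open>v\<close> is bounded linear and commutes with the
  integral. This carries the decay of solutions over to fundamental matrices.\<close>

lemma solution_fundamental_matrix_mult:
  assumes "fundamental_matrix A 0 \<Phi>"
  shows "solution A (\<lambda>t. \<Phi> t *v v)" and "\<Phi> 0 = mat 1"
proof -
  have int: "((\<lambda>\<tau>. A \<tau> ** \<Phi> \<tau>) has_integral (\<Phi> t - mat 1)) {0..t}" if "t \<ge> 0" for t
    using assms that by (simp add: fundamental_matrix_def)
  show \<Phi>0: "\<Phi> 0 = mat 1"
    \<comment> \<open>The integral over the one-point interval is zero.\<close>
    using has_integral_unique[OF int[of 0]] has_integral_refl(2)[of _ "0::real"] by force
  have "continuous_on {0..} (\<lambda>t. \<Phi> t *v v)"
    using bounded_linear.continuous_on[OF bounded_linear_matrix_vector_mult_left] assms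
    by (auto simp: fundamental_matrix_def)
  moreover have "((\<lambda>\<tau>. A \<tau> *v (\<Phi> \<tau> *v v)) has_integral (\<Phi> t *v v - \<Phi> 0 *v v)) {0..t}" if "t \<ge> 0" for t
    using has_integral_linear[OF int[OF that] bounded_linear_matrix_vector_mult_left[of v]]
    by (simp add: o_def \<Phi>0 matrix_vector_mul_assoc matrix_vector_mult_diff_rdistrib)
  ultimately show "solution A (\<lambda>t. \<Phi> t *v v)"
    by (simp add: solution_def)
qed

text \<open>The rate is that of the maximum norm; the constant, the square root of the dimension, is
  the price of passing to the Euclidean norm.\<close>

lemma uniformly_exponentially_stable_modes:
  assumes "\<epsilon> > 0"
  shows "uniformly_exponentially_stable (modes \<epsilon> :: (real^'n^'n) set)"
proof -
  let ?C = "sqrt (real CARD('n))"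
  have "onorm ((*v) (\<Phi> t)) \<le> ?C * exp (- \<epsilon> * t)"
    if A: "switching_law (modes \<epsilon>) A" and \<Phi>: "fundamental_matrix A 0 \<Phi>" and "t \<ge> 0"
    for A :: "real \<Rightarrow> real^'n^'n" and \<Phi> t
  proof (rule onorm_le)
    fix v :: "real^'n"
    have "infnorm (\<Phi> t *v v) \<le> exp (- \<epsilon> * t) * infnorm (\<Phi> 0 *v v)"
      using A assms \<open>t \<ge> 0\<close>
      by (intro modes_infnorm_decay[OF _ solution_fundamental_matrix_mult(1)[OF \<Phi>]])
        (auto simp: switching_law_def)
    also have "\<dots> \<le> exp (- \<epsilon> * t) * norm v"
      using infnorm_le_norm[of v] by (simp add: solution_fundamental_matrix_mult(2)[OF \<Phi>])
    finally have decay: "infnorm (\<Phi> t *v v) \<le> exp (- \<epsilon> * t) * norm v" .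
    have "norm (\<Phi> t *v v) \<le> ?C * infnorm (\<Phi> t *v v)"
      using norm_le_infnorm[of "\<Phi> t *v v"] by simp
    also have "\<dots> \<le> ?C * (exp (- \<epsilon> * t) * norm v)"
      using decay by (rule mult_left_mono) simp
    finally show "norm (\<Phi> t *v v) \<le> ?C * exp (- \<epsilon> * t) * norm v"
      by (simp only: mult.assoc)
  qed
  then show ?thesis
    unfolding uniformly_exponentially_stable_def using assms
    by (intro exI[of _ ?C] exI[of _ \<epsilon>]) auto
qed

text \<open>For a constant mode with \<open>y $ k = 1\<close>, the rescaled solution
  \<open>w t = exp (\<epsilon> * t) *\<^sub>R x t\<close> keeps its \<open>k\<close>-th coordinate
  \<open>v $ k\<close>. Hence it satisfies \<open>w' = v $ k *\<^sub>R y - w\<close> and relaxes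
  along a segment to \<open>v $ k *\<^sub>R y\<close>.\<close>

lemma trajectory_modes:
  fixes v y :: "real^'n"
  assumes "infnorm y \<le> 1" "y $ k = 1"
  shows "trajectory (modes \<epsilon>) (\<lambda>t. exp (- \<epsilon> * t) *\<^sub>R (v $ k *\<^sub>R y + exp (- t) *\<^sub>R (v - v $ k *\<^sub>R y)))"
    (is "trajectory _ ?x")
proof -
  have rhs: "mode \<epsilon> k y *v ?x t = - \<epsilon> *\<^sub>R ?x t - exp (- \<epsilon> * t) *\<^sub>R exp (- t) *\<^sub>R (v - v $ k *\<^sub>R y)" for t
    using assms(2) by (simp add: mode_mult_vec algebra_simps)
  have "(?x has_vector_derivative mode \<epsilon> k y *v ?x t) (at t within S)" for t S
    unfolding rhs by (auto intro!: derivative_eq_intros simp: algebra_simps)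
  then have "((\<lambda>\<tau>. mode \<epsilon> k y *v ?x \<tau>) has_integral (?x t - ?x 0)) {0..t}" if "t \<ge> 0" for t
    using that by (intro fundamental_theorem_of_calculus) auto
  moreover have "continuous_on {0..} ?x"
    by (intro continuous_intros)
  ultimately have "solution (\<lambda>_. mode \<epsilon> k y) ?x"
    by (simp add: solution_def)
  moreover have "switching_law (modes \<epsilon>) (\<lambda>_. mode \<epsilon> k y)"
    using assms(1) by (auto simp: switching_law_def modes_def)
  ultimately show ?thesis
    by (auto simp: trajectory_def)
qed

section \<open>Cluster points for uniform convergence on bounded sets\<close>

text \<open>Otherwise each \<open>f \<in> P\<close> has a neighbourhood that the sequence eventually
  avoids. Finitely many of these cover \<open>P\<close>, so some term of the sequence would lie
  outside \<open>P\<close>.\<close>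

lemma compactin_uniform_on_bounded_cluster_point:
  assumes P: "compactin uniform_on_bounded_topology P" and V: "\<And>m::nat. V m \<in> P"
  obtains f where "f \<in> P"
    "\<And>B \<delta>. bounded B \<Longrightarrow> \<delta> > 0 \<Longrightarrow> \<exists>\<^sub>F m in sequentially. \<forall>x\<in>B. \<bar>V m x - f x\<bar> < \<delta>"
proof (rule ccontr)
  assume "\<not> thesis"
  with that have "\<forall>f\<in>P. \<exists>B \<delta>. bounded B \<and> \<delta> > 0 \<and>
      (\<forall>\<^sub>F m in sequentially. \<not> (\<forall>x\<in>B. \<bar>V m x - f x\<bar> < \<delta>))"
    unfolding frequently_def by blast
  from bchoice[OF this] obtain B where "\<forall>f\<in>P. \<exists>\<delta>. bounded (B f) \<and> \<delta> > 0 \<and>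
      (\<forall>\<^sub>F m in sequentially. \<not> (\<forall>x\<in>B f. \<bar>V m x - f x\<bar> < \<delta>))" ..
  from bchoice[OF this] obtain \<delta> where B: "\<And>f. f \<in> P \<Longrightarrow> bounded (B f)" and \<delta>: "\<And>f. f \<in> P \<Longrightarrow> \<delta> f > 0"
    and away: "\<And>f. f \<in> P \<Longrightarrow> \<forall>\<^sub>F m in sequentially. \<not> (\<forall>x\<in>B f. \<bar>V m x - f x\<bar> < \<delta> f)"
    by blast
  \<comment> \<open>The uniform gap \<open>\<eta> < \<delta> f\<close> makes this set open; the
    pointwise condition \<open>< \<delta> f\<close> alone need not, as the supremum over
    \<open>B f\<close> may equal \<open>\<delta> f\<close>.\<close>
  define U where "U f = {g. \<exists>\<eta><\<delta> f. \<forall>x\<in>B f. \<bar>g x - f x\<bar> < \<eta>}" for f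
  have openin_U: "openin uniform_on_bounded_topology (U f)" if "f \<in> P" for f
    unfolding openin_uniform_on_bounded_topology
  proof
    fix g assume "g \<in> U f"
    then obtain \<eta> where \<eta>: "\<eta> < \<delta> f" "\<And>x. x \<in> B f \<Longrightarrow> \<bar>g x - f x\<bar> < \<eta>"
      by (auto simp: U_def)
    have "{h. \<forall>x\<in>B f. \<bar>h x - g x\<bar> < (\<delta> f - \<eta>) / 2} \<subseteq> U f"
    proof
      fix h assume h: "h \<in> {h. \<forall>x\<in>B f. \<bar>h x - g x\<bar> < (\<delta> f - \<eta>) / 2}"
      have "\<bar>h x - f x\<bar> < (\<delta> f + \<eta>) / 2" if "x \<in> B f" for x
      proof -
        have "\<bar>h x - g x\<bar> < (\<delta> f - \<eta>) / 2"
          using h that by blast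
        moreover have "\<bar>h x - f x\<bar> \<le> \<bar>h x - g x\<bar> + \<bar>g x - f x\<bar>"
          by simp
        moreover have "(\<delta> f + \<eta>) / 2 = (\<delta> f - \<eta>) / 2 + \<eta>"
          by (simp add: field_simps)
        ultimately show ?thesis
          using \<eta>(2)[OF that] by linarith
      qed
      then show "h \<in> U f"
        unfolding U_def using \<eta>(1) by (auto intro!: exI[of _ "(\<delta> f + \<eta>) / 2"])
    qed
    then show "\<exists>B \<epsilon>. bounded B \<and> \<epsilon> > 0 \<and> {h. \<forall>x\<in>B. \<bar>h x - g x\<bar> < \<epsilon>} \<subseteq> U f"
      using B[OF that] \<eta>(1) by (intro exI[of _ "B f"] exI[of _ "(\<delta> f - \<eta>) / 2"]) auto
  qed
  have "P \<subseteq> \<Union>(U ` P)"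
  proof
    fix f assume "f \<in> P"
    then have "f \<in> U f"
      using \<delta>[of f] by (auto simp: U_def intro!: exI[of _ "\<delta> f / 2"])
    with \<open>f \<in> P\<close> show "f \<in> \<Union>(U ` P)" by blast
  qed
  then obtain \<F> where "finite \<F>" "\<F> \<subseteq> U ` P" and cover: "P \<subseteq> \<Union>\<F>"
    using P[unfolded compactin_def, THEN conjunct2, THEN spec, of "U ` P"] openin_U by auto
  then obtain Q where Q: "finite Q" "Q \<subseteq> P" "\<F> = U ` Q"
    by (meson finite_subset_image)
  have "\<forall>\<^sub>F m in sequentially. \<forall>f\<in>Q. \<not> (\<forall>x\<in>B f. \<bar>V m x - f x\<bar> < \<delta> f)"
    using away Q by (intro eventually_ball_finite) auto
  from eventually_happens'[OF sequentially_bot this]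
  obtain m where m: "\<forall>f\<in>Q. \<not> (\<forall>x\<in>B f. \<bar>V m x - f x\<bar> < \<delta> f)" ..
  obtain f where "f \<in> Q" "V m \<in> U f"
    using V[of m] cover Q(3) by auto
  then obtain \<eta> where "\<eta> < \<delta> f" "\<forall>x\<in>B f. \<bar>V m x - f x\<bar> < \<eta>"
    by (auto simp: U_def)
  then have "\<forall>x\<in>B f. \<bar>V m x - f x\<bar> < \<delta> f"
    by (meson less_trans)
  with m \<open>f \<in> Q\<close> show False by blast
qed

text \<open>The moving points \<open>p m\<close> together with \<open>x\<close> form a bounded set,
  so uniform closeness of \<open>V m\<close> to \<open>f\<close> is available at all of them for the
  same \<open>m\<close>.\<close>

lemma cluster_point_le:
  fixes f :: "'a::metric_space \<Rightarrow> real"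
  assumes f: "\<And>B \<delta>. bounded B \<Longrightarrow> \<delta> > 0 \<Longrightarrow> \<exists>\<^sub>F m in sequentially. \<forall>x\<in>B. \<bar>V m x - f x\<bar> < \<delta>"
    and "isCont f q" and q: "p \<longlonglongrightarrow> q" and V: "\<And>m. V m (p m) \<le> V m x"
  shows "f q \<le> f x"
proof (rule ccontr)
  assume "\<not> f q \<le> f x"
  \<comment> \<open>One third each for the error at \<open>x\<close>, the error at
    \<open>p m\<close>, and the continuity of \<open>f\<close> at \<open>q\<close>.\<close>
  define \<delta> where "\<delta> = (f q - f x) / 3"
  have "\<delta> > 0"
    using \<open>\<not> f q \<le> f x\<close> by (simp add: \<delta>_def)
  have "bounded (insert x (range p))"
    using convergent_imp_bounded[OF q] by simp
  from f[OF this \<open>\<delta> > 0\<close>]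
  have "\<exists>\<^sub>F m in sequentially. \<forall>z\<in>insert x (range p). \<bar>V m z - f z\<bar> < \<delta>" .
  moreover have "\<forall>\<^sub>F m in sequentially. f (p m) > f q - \<delta>"
    using isCont_tendsto_compose[OF \<open>isCont f q\<close> q] \<open>\<delta> > 0\<close> by (intro order_tendstoD) auto
  ultimately have "\<exists>\<^sub>F m in sequentially.
      (\<forall>z\<in>insert x (range p). \<bar>V m z - f z\<bar> < \<delta>) \<and> f (p m) > f q - \<delta>"
    by (rule frequently_rev_mp[OF _ eventually_mono]) auto
  then obtain m where "\<bar>V m x - f x\<bar> < \<delta>" "\<bar>V m (p m) - f (p m)\<bar> < \<delta>" "f (p m) > f q - \<delta>"
    using frequently_ex by blast
  moreover have "3 * \<delta> = f q - f x"
    by (simp add: \<delta>_def)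
  ultimately show False
    using V[of m] by (auto simp: abs_less_iff)
qed

section \<open>Analyticity along coordinate lines\<close>

text \<open>On the line, every monomial with a positive exponent at some \<open>i \<noteq> j\<close>
  vanishes, so only the multi-indices \<open>e n\<close> survive and the sum becomes a power series
  in one variable.\<close>

lemma real_analytic_on_line:
  fixes f :: "real^'n \<Rightarrow> real"
  assumes "f real_analytic_on S" "a \<in> S"
  obtains r c where "r > 0" "\<And>s. \<bar>s\<bar> < r \<Longrightarrow> (\<lambda>n. c n * s ^ n) sums f (a + s *\<^sub>R axis j 1)"
proof -
  obtain r c where "r > 0" and c: "\<And>x. x \<in> ball a r \<Longrightarrow>
      ((\<lambda>\<alpha>. c \<alpha> * (\<Prod>i\<in>UNIV. (x $ i - a $ i) ^ \<alpha> i)) has_sum f x) UNIV"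
    using assms unfolding real_analytic_on_def by metis
  define e where "e n = (\<lambda>i. if i = j then n else 0)" for n :: nat
  have "inj e"
    by (rule injI) (metis e_def)
  have "(\<lambda>n. c (e n) * s ^ n) sums f (a + s *\<^sub>R axis j 1)" if "\<bar>s\<bar> < r" for s
  proof -
    define x where "x = a + s *\<^sub>R axis j 1"
    have diff: "x $ i - a $ i = (if i = j then s else 0)" for i
      by (simp add: x_def axis_def)
    have "x \<in> ball a r"
      using that by (simp add: x_def dist_norm)
    from c[OF this]
    have sum: "((\<lambda>\<alpha>. c \<alpha> * (\<Prod>i\<in>UNIV. (if i = j then s else 0) ^ \<alpha> i)) has_sum f x) UNIV"
      by (simp only: diff)
    have zero: "(\<Prod>i\<in>UNIV. (if i = j then s else 0) ^ \<alpha> i) = 0" if "\<alpha> \<notin> range e" for \<alpha>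
    proof -
      have "\<alpha> \<noteq> e (\<alpha> j)"
        using that by blast
      then obtain i where "i \<noteq> j" "\<alpha> i \<noteq> 0"
        by (auto simp: e_def fun_eq_iff split: if_splits)
      then show ?thesis
        by (intro prod_zero) (auto intro!: bexI[of _ i])
    qed
    have "((\<lambda>\<alpha>. c \<alpha> * (\<Prod>i\<in>UNIV. (if i = j then s else 0) ^ \<alpha> i)) has_sum f x) (range e)"
      using sum zero by (subst has_sum_cong_neutral) auto
    then have "((\<lambda>n. c (e n) * (\<Prod>i\<in>UNIV. (if i = j then s else 0) ^ e n i)) has_sum f x) UNIV"
      by (simp add: has_sum_reindex[OF \<open>inj e\<close>] o_def)
    moreover have "(\<Prod>i\<in>UNIV. (if i = j then s else 0) ^ e n i) = s ^ n" for n
    proof -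
      have "(\<Prod>i\<in>UNIV. (if i = j then s else 0) ^ e n i) = (\<Prod>i\<in>UNIV. if i = j then s ^ n else 1)"
        by (intro prod.cong) (auto simp: e_def)
      then show ?thesis by simp
    qed
    ultimately show ?thesis
      by (simp add: has_sum_imp_sums x_def)
  qed
  with \<open>r > 0\<close> show thesis
    by (rule that)
qed

text \<open>The interior \<open>E\<close> of the level set is open and nonempty. It is also closed,
  since at a point of its closure \<open>g - K\<close> has a non-isolated zero and its power series
  there must vanish. Connectedness of the real line finishes the proof.\<close>

lemma analytic_identity_real:
  fixes g :: "real \<Rightarrow> real"
  assumes ps: "\<And>a. \<exists>r>0. \<exists>c. \<forall>s. \<bar>s\<bar> < r \<longrightarrow> (\<lambda>n. c n * s ^ n) sums g (a + s)"
    and cont: "continuous_on UNIV g"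
    and U: "open U" "U \<noteq> {}" "\<And>s. s \<in> U \<Longrightarrow> g s = K"
  shows "g s = K"
proof -
  define E where "E = interior {s. g s = K}"
  have "U \<subseteq> E"
    unfolding E_def using U by (intro interior_maximal) auto
  have "closed {s. g s = K}"
    using continuous_closed_vimage[of "{K}" g] cont
    by (simp add: continuous_on_eq_continuous_at vimage_def)
  then have clE: "closure E \<subseteq> {s. g s = K}"
    unfolding E_def by (intro closure_minimal interior_subset)
  have "closure E \<subseteq> E"
  proof
    fix a assume a: "a \<in> closure E"
    obtain r c where "r > 0" and c: "\<And>s. \<bar>s\<bar> < r \<Longrightarrow> (\<lambda>n. c n * s ^ n) sums g (a + s)"
      using ps[of a] by blast
    \<comment> \<open>Coefficients at \<open>a\<close> of \<open>g - K\<close>.\<close>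
    define d where "d n = (if n = 0 then c 0 - K else c n)" for n
    have d: "(\<lambda>n. d n * (x - a) ^ n) sums (g x - K)" if "norm (x - a) < r" for x
    proof -
      have "(\<lambda>n. c n * (x - a) ^ n - (if n = 0 then K else 0)) sums (g x - K)"
        using c[of "x - a"] that sums_single[of 0 "\<lambda>_. K"] by (intro sums_diff) auto
      moreover have "(\<lambda>n. c n * (x - a) ^ n - (if n = 0 then K else 0)) = (\<lambda>n. d n * (x - a) ^ n)"
        by (auto simp: d_def)
      ultimately show ?thesis by simp
    qed
    have ga: "g a - K = 0"
      using a clE by auto
    \<comment> \<open>A nonzero coefficient would make \<open>a\<close> an isolated zero of
      \<open>g - K\<close>.\<close>
    have dm: "d m = 0" if "m > 0" for m
    proof (rule ccontr)
      assume "d m \<noteq> 0"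
      obtain t where "t > 0" and nz: "\<And>z. z \<in> cball a t - {a} \<Longrightarrow> g z - K \<noteq> 0"
        using powser_0_nonzero[OF \<open>r > 0\<close> d ga \<open>d m \<noteq> 0\<close> \<open>m > 0\<close>] by metis
      have "ball a t \<inter> E \<noteq> {}"
        using a \<open>t > 0\<close> by (metis centre_in_ball disjoint_iff open_ball open_Int_closure_eq_empty)
      moreover have "open (ball a t \<inter> E)"
        by (simp add: E_def open_Int)
      \<comment> \<open>A nonempty open set of reals is infinite, hence contains a point other than
        \<open>a\<close>.\<close>
      ultimately have "infinite (ball a t \<inter> E)"
        using finite_imp_not_open by blast
      then obtain z where "z \<in> ball a t \<inter> E" "z \<noteq> a"
        by (metis finite.emptyI finite_insert finite_subset insertCI subsetI)
      then have "g z - K \<noteq> 0" "g z = K"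
        using nz[of z] interior_subset[of "{s. g s = K}"] by (auto simp: E_def)
      then show False by simp
    qed
    have const: "g x - K = d 0" if "norm (x - a) < r" for x
    proof -
      have "d n * (x - a) ^ n = (if n = 0 then d 0 else 0)" for n
        using dm[of n] by (cases "n = 0") auto
      then have "(\<lambda>n. if n = 0 then d 0 else 0) sums (g x - K)"
        using d[OF that] by simp
      then show ?thesis
        using sums_single[of 0 "\<lambda>_. d 0"] by (simp add: sums_unique2)
    qed
    have "g x = K" if "x \<in> ball a r" for x
      using const[of a] const[of x] that ga \<open>r > 0\<close> by (simp add: dist_norm norm_minus_commute)
    then have "ball a r \<subseteq> E"
      unfolding E_def by (intro interior_maximal) auto
    with \<open>r > 0\<close> show "a \<in> E" by auto
  qed
  then have "closed E"
    by (metis closure_subset_eq)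
  moreover have "open E"
    by (simp add: E_def)
  ultimately have "E = UNIV"
    using \<open>U \<subseteq> E\<close> U(2) clopen[of E] by auto
  then show ?thesis
    using interior_subset[of "{s. g s = K}"] by (auto simp: E_def)
qed

lemma analytic_face_constant_imp_zero:
  fixes f :: "real^'n \<Rightarrow> real"
  assumes card: "CARD('n) \<ge> 2" and f: "f \<in> analytic_off_origin" and "f 0 = 0"
    and face: "\<And>x y k. x $ k = y $ k \<Longrightarrow> infnorm x \<le> \<bar>x $ k\<bar> \<Longrightarrow> infnorm y \<le> \<bar>y $ k\<bar> \<Longrightarrow> f x = f y"
  shows "f x = 0"
proof (cases "x = 0")
  case False
  have cont: "continuous_on UNIV f" and an: "f real_analytic_on (UNIV - {0})"
    using f by (auto simp: analytic_off_origin_def)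
  have infnorm_axis: "infnorm (c *\<^sub>R axis j 1 + s *\<^sub>R axis k 1 :: real^'n) \<le> max \<bar>c\<bar> \<bar>s\<bar>" if "j \<noteq> k" for c s j k
    using that by (intro infnorm_leI_cart) (auto simp: axis_def)
  have line: "f (c *\<^sub>R axis k 1 + s *\<^sub>R axis j 1) = f (c *\<^sub>R axis k 1)" if "j \<noteq> k" "c \<noteq> 0" for c s j k
  proof -
    define g where "g s = f (c *\<^sub>R axis k 1 + s *\<^sub>R axis j 1)" for s
    have "g s = f (c *\<^sub>R axis k 1)"
    \<comment> \<open>For these parameters the point lies on a face of the cube of half-side
      \<open>\<bar>c\<bar>\<close>, where \<open>face\<close> applies.\<close>
    proof (rule analytic_identity_real[where g = g and U = "{- \<bar>c\<bar> <..< \<bar>c\<bar>}"])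
      fix a
      have "(c *\<^sub>R axis k 1 + a *\<^sub>R axis j 1 :: real^'n) $ k \<noteq> 0"
        using that by (simp add: axis_def)
      then have "c *\<^sub>R axis k 1 + a *\<^sub>R axis j 1 \<in> (UNIV - {0} :: (real^'n) set)"
        by (metis DiffI UNIV_I singletonD zero_index)
      from real_analytic_on_line[OF an this, of j] obtain r d where "r > 0"
        "\<And>s. \<bar>s\<bar> < r \<Longrightarrow> (\<lambda>n. d n * s ^ n) sums f (c *\<^sub>R axis k 1 + a *\<^sub>R axis j 1 + s *\<^sub>R axis j 1)"
        by blast
      then show "\<exists>r>0. \<exists>c. \<forall>s. \<bar>s\<bar> < r \<longrightarrow> (\<lambda>n. c n * s ^ n) sums g (a + s)"
        by (auto simp: g_def scaleR_add_left add.assoc)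
    next
      show "continuous_on UNIV g"
        unfolding g_def by (intro continuous_on_compose2[OF cont] continuous_intros) auto
      show "open {- \<bar>c\<bar> <..< \<bar>c\<bar>}" "{- \<bar>c\<bar> <..< \<bar>c\<bar>} \<noteq> {}"
        using that by auto
    next
      fix s assume "s \<in> {- \<bar>c\<bar> <..< \<bar>c\<bar>}"
      then have "max \<bar>c\<bar> \<bar>s\<bar> = \<bar>c\<bar>" "max \<bar>c\<bar> \<bar>0::real\<bar> = \<bar>c\<bar>"
        by auto
      then show "g s = f (c *\<^sub>R axis k 1)"
        unfolding g_def using infnorm_axis[of k j c s] infnorm_axis[of k j c 0] that
        by (intro face[where k = k]) (auto simp: axis_def)
    qed
    then show ?thesis
      by (simp add: g_def)
  qed
  have "\<exists>j. infnorm x \<le> \<bar>x $ j\<bar>"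
  proof -
    have "infnorm x \<in> {\<bar>x $ i\<bar> | i. i \<in> UNIV}"
      using Max_in[of "range (\<lambda>i. \<bar>x $ i\<bar>)"]
      by (simp add: infnorm_cart full_SetCompr_eq cSup_eq_Max)
    then show ?thesis by auto
  qed
  then obtain j where j: "infnorm x \<le> \<bar>x $ j\<bar>" ..
  define u where "u = x $ j"
  have "u \<noteq> 0"
    using j False infnorm_pos_lt[of x] by (auto simp: u_def)
  obtain k where "k \<noteq> j"
    using card by (metis card_2_iff' ex_card)
  \<comment> \<open>Both points lie on the face where the \<open>j\<close>-th coordinate equals
    \<open>u\<close>.\<close>
  have x: "f x = f (u *\<^sub>R axis j 1)"
    using infnorm_axis[of j k u 0] \<open>k \<noteq> j\<close> j
    by (intro face[where k = j]) (auto simp: u_def axis_def)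
  \<comment> \<open>The point \<open>c *\<^sub>R axis k 1 + u *\<^sub>R axis j 1\<close> lies on
    both lines: the one through \<open>c *\<^sub>R axis k 1\<close> and the one through
    \<open>u *\<^sub>R axis j 1\<close>.\<close>
  have "f (c *\<^sub>R axis k 1) = f x" if "c \<noteq> 0" "\<bar>c\<bar> \<le> \<bar>u\<bar>" for c
    using x line[of j k c u] line[of k j u c] \<open>k \<noteq> j\<close> \<open>u \<noteq> 0\<close> that
    by (simp add: add.commute)
  then have ev: "\<forall>\<^sub>F c in at 0. f (c *\<^sub>R axis k 1) = f x"
    unfolding eventually_at using \<open>u \<noteq> 0\<close>
    by (intro exI[of _ "\<bar>u\<bar>"]) (auto simp: dist_norm)
  have "isCont f 0"
    using cont by (simp add: continuous_on_eq_continuous_at)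
  moreover have "((\<lambda>c. c *\<^sub>R axis k 1 :: real^'n) \<longlongrightarrow> 0 *\<^sub>R axis k 1) (at 0)"
    by (intro tendsto_intros)
  ultimately have "((\<lambda>c. f (c *\<^sub>R axis k 1)) \<longlongrightarrow> f 0) (at 0)"
    by (intro isCont_tendsto_compose[of 0 f]) auto
  then have "((\<lambda>c::real. f x) \<longlongrightarrow> f 0) (at 0)"
    by (rule Lim_transform_eventually) (use ev in auto)
  then show ?thesis
    using \<open>f 0 = 0\<close> by (simp add: tendsto_const_iff)
qed (simp add: assms(3))

section \<open>Passage to the limit of vanishing damping\<close>

theorem theorem4p2:
  fixes P :: "(real^'n \<Rightarrow> real) set"
  assumes "CARD('n) \<ge> 2"
    and "compactin (subtopology uniform_on_bounded_topology analytic_off_origin) P"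
    and "(\<lambda>x. 0) \<notin> P"
  shows "\<not> universal_class P"
proof
  assume univ: "universal_class P"
  have P: "compactin uniform_on_bounded_topology P" and sub: "P \<subseteq> analytic_off_origin"
    using assms(2) by (auto simp: compactin_subtopology)
  define \<epsilon> where "\<epsilon> m = 1 / (real m + 1)" for m :: nat
  have "\<exists>V\<in>P. common_lyapunov_function (modes (\<epsilon> m)) V" for m
    using univ bounded_modes uniformly_exponentially_stable_modes[of "\<epsilon> m"]
    by (auto simp: universal_class_def \<epsilon>_def)
  then obtain V where V: "\<And>m. V m \<in> P" and L: "\<And>m. common_lyapunov_function (modes (\<epsilon> m)) (V m)"
    by metis
  obtain f where f: "f \<in> P" and cluster:
      "\<And>B \<delta>. bounded B \<Longrightarrow> \<delta> > 0 \<Longrightarrow> \<exists>\<^sub>F m in sequentially. \<forall>x\<in>B. \<bar>V m x - f x\<bar> < \<delta>"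
    by (rule compactin_uniform_on_bounded_cluster_point[where V = V, OF P V]) blast
  have "isCont f x" for x
    using f sub by (auto simp: analytic_off_origin_def continuous_on_eq_continuous_at)
  have "f 0 = 0"
  proof -
    have "\<exists>\<^sub>F m in sequentially. \<bar>f 0\<bar> < \<delta>" if "\<delta> > 0" for \<delta>
      using cluster[of "{0}" \<delta>] that L by (simp add: common_lyapunov_function_def)
    then have "\<bar>f 0\<bar> < \<delta>" if "\<delta> > 0" for \<delta>
      using that by (simp add: frequently_const_iff)
    from this[of "\<bar>f 0\<bar>"] show ?thesis by auto
  qed
  \<comment> \<open>In the limit system the trajectory from \<open>x\<close> converges to
    \<open>x $ k *\<^sub>R y\<close>, and \<open>f\<close> does not increase along it.\<close>
  have reach: "f (x $ k *\<^sub>R y) \<le> f x" if y: "infnorm y \<le> 1" "y $ k = 1" for x y k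
  proof (cases "x = 0")
    case False
    define z where "z m = (\<lambda>t. exp (- \<epsilon> m * t) *\<^sub>R (x $ k *\<^sub>R y + exp (- t) *\<^sub>R (x - x $ k *\<^sub>R y)))" for m
    have "z m 0 = x" for m
      by (simp add: z_def)
    have "trajectory (modes (\<epsilon> m)) (z m)" for m
      unfolding z_def by (rule trajectory_modes[OF y])
    then have "strict_antimono_on {0..} (\<lambda>t. V m (z m t))" for m
      using L[of m] False \<open>z m 0 = x\<close> by (simp add: common_lyapunov_function_def)
    \<comment> \<open>The time \<open>sqrt m\<close> tends to infinity, which completes the
      relaxation towards \<open>x $ k *\<^sub>R y\<close>, yet \<open>\<epsilon> m * sqrt m\<close>
      tends to 0, so the damping disappears. For \<open>m = 0\<close> the time is 0 and equality
      holds.\<close>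
    then have le: "V m (z m (sqrt (real m))) \<le> V m x" for m
      using \<open>z m 0 = x\<close> monotone_onD[of "{0..}" "(<)" "(>)" "\<lambda>t. V m (z m t)" 0 "sqrt (real m)"]
      by (cases "m = 0") (auto simp: less_imp_le)
    have "(\<lambda>m. z m (sqrt (real m))) \<longlonglongrightarrow> 1 *\<^sub>R (x $ k *\<^sub>R y + 0 *\<^sub>R (x - x $ k *\<^sub>R y))"
      unfolding z_def
    proof (intro tendsto_intros)
      show "(\<lambda>m. exp (- \<epsilon> m * sqrt (real m))) \<longlonglongrightarrow> 1"
        unfolding \<epsilon>_def by real_asymp
      show "(\<lambda>m. exp (- sqrt (real m))) \<longlonglongrightarrow> 0"
        by real_asymp
    qed
    then have "(\<lambda>m. z m (sqrt (real m))) \<longlonglongrightarrow> x $ k *\<^sub>R y"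
      by simp
    from cluster_point_le[OF cluster \<open>isCont f (x $ k *\<^sub>R y)\<close> this le] show ?thesis .
  qed auto
  have face: "f x \<le> f y" if "x $ k = y $ k" "infnorm x \<le> \<bar>x $ k\<bar>" "infnorm y \<le> \<bar>y $ k\<bar>" for x y k
  proof (cases "x $ k = 0")
    case True
    then have "x = y"
      using that infnorm_eq_0[of x] infnorm_eq_0[of y] infnorm_pos_le[of x] infnorm_pos_le[of y] by simp
    then show ?thesis by simp
  next
    case False
    \<comment> \<open>Start at \<open>y\<close> and aim at \<open>x\<close> rescaled to have
      \<open>k\<close>-th coordinate 1; since \<open>y $ k = x $ k\<close>, the limit point is
      \<open>x\<close> itself.\<close>
    have "f (y $ k *\<^sub>R (1 / x $ k) *\<^sub>R x) \<le> f y"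
      using False that(2) by (intro reach) (auto simp: infnorm_mul)
    with False that(1) show ?thesis by simp
  qed
  have "f x = 0" for x
  proof (rule analytic_face_constant_imp_zero[OF assms(1)])
    show "f x = f y" if "x $ k = y $ k" "infnorm x \<le> \<bar>x $ k\<bar>" "infnorm y \<le> \<bar>y $ k\<bar>" for x y k
      using that by (intro antisym face[of x k y] face[of y k x]) auto
  qed (use f sub \<open>f 0 = 0\<close> in auto)
  then have "f = (\<lambda>x. 0)"
    by auto
  with f assms(3) show False by simp
qed

end
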